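(* Let $f:\mathbb{R}^d\to\mathbb{R}^d$ and $g:\mathbb{R}^d\to\mathbb{R}^{d\times m}$ be continuously differentiable and suppose there are constants $c\in(0,\infty)$, $\alpha>0$, $\kappa>0$ such that for all $x,y\in\mathbb{R}^d$ $$\|Df(x)\|\le c(1+\|x\|^c),\qquad \langle f(x)-f(y),x-y\rangle\le\alpha\|x-y\|^2,\qquad \|g(x)-g(y)\|_F\le\kappa\|x-y\|,$$ so that, with the same $c$, $\|f(x)\|\le(2c+\|f(0)\|)(1+\|x\|^{c+1})$ for all $x\in\mathbb{R}^d$. Let $\{h_n\}_{n\in\mathbb{N}}$ be a timestepping strategy satisfying the standing assumption on the timesteps (given in the context), and let $\{Y_n\}_{n\in\mathbb{N}}$ be a solution of $$Y_{n+1}=Y_n+h_{n+1}\left[f(Y_n)\mathcal{I}_{\{h_{n+1}>h_{\min}\}}+\frac{f(Y_n)}{1+h_{\min}\|f(Y_n)\|}\mathcal{I}_{\{h_{n+1}=h_{\min}\}}\right]+g(Y_n)\bigl(W(t_{n+1})-W(t_n)\bigr),\quad n=0,\dots,N-1.$$ Let $\delta\le h_{\max}$. Then $\{h_n\}_{n\in\mathbb{N}}$ is admissible for this scheme (as defined in the context) if, for each $n=0,\dots,N-1$, one of the following holds whenever $h_{\min}<h_{n+1}<h_{\max}$: (i) $h_{n+1}\le\delta/\|f(Y_n)\|$; (ii) $h_{n+1}\le\delta/(1+\|Y_n\|^{1+c})$; (iii) $h_{n+1}\le\delta\|Y_n\|/\|f(Y_n)\|$; (iv) $h_{n+1}\l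e\delta\|Y_n\|/(1+\|Y_n\|^{1+c})$.
   Context: $W$ is an $m$-dimensional Wiener process on a probability space $(\Omega,\mathcal{F},\mathbb{P})$ and $(\mathcal{F}_t)_{t\ge0}$ is its natural filtration; $T\in(0,\infty)$ is fixed. $\|\cdot\|$ is the Euclidean norm on $\mathbb{R}^d$ (and the induced matrix norm), $\|\cdot\|_F$ the Frobenius norm, $\mathcal{I}_A$ the indicator of the event $A$. The initial value $Y_0=X_0\in\mathbb{R}^d$ is given. The inequalities in (i) and (iii) are read as imposing no restriction when $f(Y_n)=0$. Random mesh. $\{h_n\}_{n\ge1}$ is a sequence of random timesteps, $t_0=0$, $t_n=\sum_{i=1}^n h_i$. Each $t_n$ is an $(\mathcal{F}_t)$-stopping time, and $\mathcal{F}_{t_n}=\{A\in\mathcal{F}: A\cap\{t_n\le t\}\in\mathcal{F}_t \text{ for all } t\ge 0\}$. Standing assumption on the timesteps: each $h_n$ is $\mathcal{F}_{t_{n-1}}$-measurable; $N$ is the random integer $N:=\max\{n\in\mathbb{N}: t_{n-1}<T\}$, and $t_N=T$; minimum and maximum stepsizes are imposed, i.e. $h_{\min}\le h_n\le h_{\max}$, in a fixed ratio $0<\rho\in\mathbb{R}$, so that $h_{\max}=\rho h_{\min}$. Definition (admissible timestepping strategy). For $f,g$ satisfying the conditions in the claim and $\{Y_n\}$ a solution of the scheme, $\{h_n\}_{n\in\mathbb{N}}$ is an admissible timestepping strategy for the scheme if it satisfies the standing assumption on the timesteps and there exist real non-negative constants $R_1,R_2<\infty$ such that, whenever $h_{\min}<h_{n+1}<h_{\max}$,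 $$\|f(Y_n)\|^2\le R_1+R_2\|Y_n\|^2,\qquad n=0,\dots,N-1.$$ *)

theory Defs
  imports "HOL-Probability.Probability"
begin

text \<open>
  Matrices in \<open>real^'m^'d\<close> (with \<open>'d\<close> rows and \<open>'m\<close> columns) carry the Frobenius norm as their
  library norm; bounded linear maps \<open>(real^'d) \<Rightarrow>\<^sub>L (real^'d)\<close> carry the operator norm induced by the
  Euclidean norm.
\<close>

lemma norm_matrix_eq_frobenius:
  fixes A :: "real^'m^'d"
  shows "norm A = sqrt (\<Sum>i\<in>UNIV. \<Sum>j\<in>UNIV. (A $ i $ j)\<^sup>2)"
  by (simp add: norm_vec_def L2_set_def sum_nonneg)

definition continuously_differentiable ::
  "('a::real_normed_vector \<Rightarrow> 'b::real_normed_vector) \<Rightarrow> ('a \<Rightarrow> 'a \<Rightarrow>\<^sub>L 'b) \<Rightarrow> bool"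
  where "continuously_differentiable f Df \<longleftrightarrow>
    (\<forall>x. (f has_derivative blinfun_apply (Df x)) (at x)) \<and> continuous_on UNIV Df"

text \<open>The index type is \<open>real\<close>, but only the values \<open>W t\<close> with \<open>0 \<le> t\<close> are ever used.\<close>

definition wiener_process :: "'a measure \<Rightarrow> (real \<Rightarrow> 'a \<Rightarrow> real^'m) \<Rightarrow> bool"
  where "wiener_process M W \<longleftrightarrow>
    prob_space M \<and>
    (\<forall>t\<ge>0. W t \<in> borel_measurable M) \<and>
    (AE \<omega> in M. W 0 \<omega> = 0) \<and>
    (AE \<omega> in M. continuous_on {0..} (\<lambda>t. W t \<omega>)) \<and>
    (\<forall>(k::nat) (s::nat \<Rightarrow> real). 0 \<le> s 0 \<and> (\<forall>i<k. s i \<le> s (Suc i)) \<longrightarrow>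
       prob_space.indep_vars M (\<lambda>_. borel) (\<lambda>i \<omega>. W (s (Suc i)) \<omega> - W (s i) \<omega>) {..<k}) \<and>
    (\<forall>s t. 0 \<le> s \<and> s < t \<longrightarrow>
       distributed M lborel (\<lambda>\<omega>. W t \<omega> - W s \<omega>)
         (\<lambda>x. ennreal (\<Prod>i\<in>UNIV. normal_density 0 (sqrt (t - s)) (x $ i))))"

text \<open>For \<open>t < 0\<close> this is the trivial \<open>\<sigma>\<close>-algebra, so negative times add nothing to the library
  notions of stopping time and of the \<open>\<sigma>\<close>-algebra of a (nonnegative) stopping time.\<close>

definition natural_filtration ::
  "'a measure \<Rightarrow> (real \<Rightarrow> 'a \<Rightarrow> 'b::topological_space) \<Rightarrow> real \<Rightarrow> 'a measure"
  where "natural_filtration M W t =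
    sigma (space M) {W s -` B \<inter> space M | s B. 0 \<le> s \<and> s \<le> t \<and> B \<in> sets borel}"

lemma filtration_natural_filtration: "filtration (space M) (natural_filtration M W)"
proof
  show "space (natural_filtration M W i) = space M" for i
    unfolding natural_filtration_def by (rule space_measure_of) auto
  fix i j :: real assume "i \<le> j"
  then have "{W s -` B \<inter> space M | s B. 0 \<le> s \<and> s \<le> i \<and> B \<in> sets borel}
    \<subseteq> {W s -` B \<inter> space M | s B. 0 \<le> s \<and> s \<le> j \<and> B \<in> sets borel}"
    by (intro Collect_mono impI) (metis order_trans)
  then show "sets (natural_filtration M W i) \<le> sets (natural_filtration M W j)"
    unfolding natural_filtration_def
    by (subst (1 2) sets_measure_of, force, force) (erule sigma_sets_mono')
qed

text \<open>Timesteps are indexed from 1; the value \<open>h 0\<close> is never used.\<close>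

definition mesh :: "(nat \<Rightarrow> 'a \<Rightarrow> real) \<Rightarrow> nat \<Rightarrow> 'a \<Rightarrow> real"
  where "mesh h n \<omega> = (\<Sum>i=1..n. h i \<omega>)"

definition num_steps :: "real \<Rightarrow> (nat \<Rightarrow> 'a \<Rightarrow> real) \<Rightarrow> 'a \<Rightarrow> nat"
  where "num_steps T h \<omega> = Max {n. 1 \<le> n \<and> mesh h (n - 1) \<omega> < T}"

definition timestepping_strategy ::
  "'a measure \<Rightarrow> (real \<Rightarrow> 'a measure) \<Rightarrow> real \<Rightarrow> real \<Rightarrow> real \<Rightarrow> real \<Rightarrow> (nat \<Rightarrow> 'a \<Rightarrow> real) \<Rightarrow> bool"
  where "timestepping_strategy M F T hmin hmax \<rho> h \<longleftrightarrow>
    0 < hmin \<and> 0 < \<rho> \<and> hmax = \<rho> * hmin \<and>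
    (\<forall>n. stopping_time F (mesh h n)) \<and>
    (\<forall>n\<ge>1. h n \<in> borel_measurable (filtration.pre_sigma (space M) F (mesh h (n - 1)))) \<and>
    (\<forall>n\<ge>1. \<forall>\<omega>\<in>space M. hmin \<le> h n \<omega> \<and> h n \<omega> \<le> hmax) \<and>
    (\<forall>\<omega>\<in>space M. mesh h (num_steps T h \<omega>) \<omega> = T)"

text \<open>The maximum defining \<open>num_steps\<close> is taken over a finite nonempty set.\<close>

lemma num_steps_set:
  assumes "timestepping_strategy M F T hmin hmax \<rho> h" "\<omega> \<in> space M" "0 < T"
  shows "finite {n. 1 \<le> n \<and> mesh h (n - 1) \<omega> < T}" "{n. 1 \<le> n \<and> mesh h (n - 1) \<omega> < T} \<noteq> {}"
proof -
  have hmin: "0 < hmin" and h: "hmin \<le> h n \<omega>" if "n \<ge> 1" for n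
    using assms(1,2) that by (auto simp: timestepping_strategy_def)
  have lower: "real n * hmin \<le> mesh h n \<omega>" for n
    using sum_bounded_below[of "{1..n}" hmin "\<lambda>i. h i \<omega>"] h by (simp add: mesh_def)
  have "{n. 1 \<le> n \<and> mesh h (n - 1) \<omega> < T} \<subseteq> {..nat \<lceil>T / hmin\<rceil> + 1}"
  proof safe
    fix n assume "1 \<le> n" "mesh h (n - 1) \<omega> < T"
    then have "real (n - 1) * hmin < T" using lower[of "n - 1"] by linarith
    then have "real (n - 1) < T / hmin" using hmin[of 1] by (simp add: pos_less_divide_eq)
    then have "real (n - 1) \<le> real (nat \<lceil>T / hmin\<rceil>)"
      using real_nat_ceiling_ge[of "T / hmin"] by linarith
    then show "n \<le> nat \<lceil>T / hmin\<rceil> + 1" by simp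
  qed
  then show "finite {n. 1 \<le> n \<and> mesh h (n - 1) \<omega> < T}" by (rule finite_subset) simp
  show "{n. 1 \<le> n \<and> mesh h (n - 1) \<omega> < T} \<noteq> {}"
    using assms(3) by (auto simp: mesh_def intro!: exI[of _ 1])
qed

definition solves_scheme ::
  "'a measure \<Rightarrow> (real \<Rightarrow> 'a \<Rightarrow> real^'m) \<Rightarrow> real \<Rightarrow> real \<Rightarrow> (real^'d \<Rightarrow> real^'d) \<Rightarrow>
   (real^'d \<Rightarrow> real^'m^'d) \<Rightarrow> real^'d \<Rightarrow> (nat \<Rightarrow> 'a \<Rightarrow> real) \<Rightarrow> (nat \<Rightarrow> 'a \<Rightarrow> real^'d) \<Rightarrow> bool"
  where "solves_scheme M W T hmin f g X0 h Y \<longleftrightarrow>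
    (\<forall>\<omega>\<in>space M. Y 0 \<omega> = X0 \<and>
      (\<forall>n<num_steps T h \<omega>. Y (Suc n) \<omega> = Y n \<omega>
        + h (Suc n) \<omega> *\<^sub>R
           (indicator {\<omega>. h (Suc n) \<omega> > hmin} \<omega> *\<^sub>R f (Y n \<omega>)
            + indicator {\<omega>. h (Suc n) \<omega> = hmin} \<omega> *\<^sub>R
                (f (Y n \<omega>) /\<^sub>R (1 + hmin * norm (f (Y n \<omega>)))))
        + g (Y n \<omega>) *v (W (mesh h (Suc n) \<omega>) \<omega> - W (mesh h n \<omega>) \<omega>)))"

text \<open>Meaningful for a solution \<open>Y\<close> of the scheme; the constants are deterministic and uniform in
  the step number.\<close>

definition admissible_strategy ::
  "'a measure \<Rightarrow> (real \<Rightarrow> 'a measure) \<Rightarrow> real \<Rightarrow> real \<Rightarrow> real \<Rightarrow> real \<Rightarrow> (real^'d \<Rightarrow> real^'d) \<Rightarrow>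
   (nat \<Rightarrow> 'a \<Rightarrow> real^'d) \<Rightarrow> (nat \<Rightarrow> 'a \<Rightarrow> real) \<Rightarrow> bool"
  where "admissible_strategy M F T hmin hmax \<rho> f Y h \<longleftrightarrow>
    timestepping_strategy M F T hmin hmax \<rho> h \<and>
    (\<exists>R1 R2. 0 \<le> R1 \<and> 0 \<le> R2 \<and>
      (\<forall>\<omega>\<in>space M. \<forall>n<num_steps T h \<omega>. hmin < h (Suc n) \<omega> \<and> h (Suc n) \<omega> < hmax \<longrightarrow>
        (norm (f (Y n \<omega>)))\<^sup>2 \<le> R1 + R2 * (norm (Y n \<omega>))\<^sup>2))"

end

theory Submission
  imports Defs
begin

text \<open>
  Admissibility is a pathwise and purely algebraic fact. The four criteria have the common form
  \<open>h \<le> \<delta> s / q\<close>, where \<open>q\<close> is \<open>\<parallel>f(Y)\<parallel>\<close> or \<open>1 + \<parallel>Y\<parallel>\<^sup>1\<^sup>+\<^sup>c\<close>, and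
  \<open>s\<close> is \<open>1\<close> or \<open>\<parallel>Y\<parallel>\<close>. As \<open>h > hmin\<close> and \<open>\<delta> \<le> hmax = \<rho> hmin\<close>, a step of this size
  can be taken only where \<open>q \<le> \<rho> s\<close> (lemma \<open>capped_step_bounds_denominator\<close>): a denominator
  too large would have forced the step down to the minimum. Both choices of \<open>q\<close> dominate
  \<open>\<parallel>f(Y)\<parallel>\<close> up to a constant, the second one because the polynomial bound on the
  derivative integrates along rays from the origin to \<open>\<parallel>f(x)\<parallel> \<le> K (1 + \<parallel>x\<parallel>\<^sup>c\<^sup>+\<^sup>1)\<close>
  (lemma \<open>polynomial_growth_of_derivative_bound\<close>). So \<open>\<parallel>f(Y)\<parallel>\<close> is at most a constant times
  \<open>1\<close> or \<open>\<parallel>Y\<parallel>\<close>, which is the required linear growth along the discrete path.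
\<close>

text \<open>
  The bound on the derivative increases with the norm, so on the ball of radius \<open>\<parallel>x\<parallel>\<close> its
  value at \<open>x\<close> holds uniformly, and the mean value inequality there gives
  \<open>\<parallel>f x\<parallel> \<le> \<parallel>f 0\<parallel> + c \<parallel>x\<parallel> + c \<parallel>x\<parallel>\<^sup>c\<^sup>+\<^sup>1\<close>; the
  linear term is absorbed by \<open>r \<le> 1 + r\<^sup>c\<^sup>+\<^sup>1\<close>.
\<close>

lemma polynomial_growth_of_derivative_bound:
  fixes f :: "'a::real_normed_vector \<Rightarrow> 'b::real_normed_vector"
  assumes deriv: "\<And>x. (f has_derivative blinfun_apply (Df x)) (at x)"
    and "0 \<le> c" and bound: "\<And>x. norm (Df x) \<le> c * (1 + norm x powr c)"
  shows "norm (f x) \<le> (2 * c + norm (f 0)) * (1 + norm x powr (c + 1))"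
proof -
  define r where "r = norm x"
  have "0 \<le> r" by (simp add: r_def)
  have powr_Suc: "r * r powr c = r powr (c + 1)"
    using \<open>0 \<le> r\<close> by (cases "r = 0") (auto simp: powr_add)
  have linear: "r \<le> 1 + r powr (c + 1)"
  proof (cases "r \<le> 1")
    case True
    then show ?thesis using powr_ge_zero[of r "c + 1"] by linarith
  next
    case False
    then have "r powr 1 \<le> r powr (c + 1)" using \<open>0 \<le> c\<close> by (intro powr_mono) auto
    then show ?thesis using False by simp
  qed
  have "norm (f x - f 0) \<le> c * (1 + r powr c) * norm (x - 0)"
  proof (rule differentiable_bound)
    show "convex (cball (0::'a) r)" by simp
    show "(f has_derivative blinfun_apply (Df y)) (at y within cball 0 r)" for y
      using deriv by (rule has_derivative_at_withinI)
    show "onorm (blinfun_apply (Df y)) \<le> c * (1 + r powr c)" if "y \<in> cball 0 r" for y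
    proof -
      have "norm y powr c \<le> r powr c" using that \<open>0 \<le> c\<close> by (intro powr_mono2) auto
      then have "c * (1 + norm y powr c) \<le> c * (1 + r powr c)"
        using \<open>0 \<le> c\<close> by (intro mult_left_mono) auto
      then show ?thesis using bound[of y] by (simp add: norm_blinfun.rep_eq)
    qed
  qed (auto simp: r_def)
  also have "c * (1 + r powr c) * norm (x - 0) = c * r + c * r powr (c + 1)"
    by (simp add: r_def[symmetric] powr_Suc[symmetric] distrib_left mult_ac)
  also have "\<dots> \<le> 2 * c * (1 + r powr (c + 1))"
    using mult_left_mono[OF linear \<open>0 \<le> c\<close>] \<open>0 \<le> c\<close> by (simp add: algebra_simps)
  finally have "norm (f x) \<le> norm (f 0) + 2 * c * (1 + r powr (c + 1))"
    using norm_triangle_ineq2[of "f x" "f 0"] by linarith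
  moreover have "0 \<le> norm (f 0) * r powr (c + 1)" by simp
  ultimately show ?thesis unfolding r_def distrib_left distrib_right by linarith
qed

lemma capped_step_bounds_denominator:
  fixes h hmin \<delta> \<rho> q s :: real
  assumes "hmin < h" and "h \<le> \<delta> * s / q" and "\<delta> \<le> \<rho> * hmin" and "0 < hmin" and "0 < q" and "0 \<le> s"
  shows "q \<le> \<rho> * s"
proof -
  have "hmin * q \<le> h * q" using assms by (intro mult_right_mono) auto
  also have "\<dots> \<le> \<delta> * s" using assms by (simp add: pos_le_divide_eq)
  also have "\<dots> \<le> \<rho> * hmin * s" using assms by (intro mult_right_mono) auto
  finally have "hmin * q \<le> hmin * (\<rho> * s)" by (simp add: ac_simps)
  then show ?thesis using \<open>0 < hmin\<close> by simp
qed

text \<open>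
  The four criteria for one step, with \<open>F\<close>, \<open>p\<close> and \<open>r\<close> standing for \<open>\<parallel>f(Y)\<parallel>\<close>,
  \<open>\<parallel>Y\<parallel>\<^sup>1\<^sup>+\<^sup>c\<close> and \<open>\<parallel>Y\<parallel>\<close>. The factor \<open>1 + K\<close> serves both denominators:
  \<open>F\<close> itself, which needs \<open>1\<close>, and \<open>1 + p\<close>, which needs \<open>K\<close>.
\<close>

lemma drift_bound_of_step_criterion:
  fixes h hmin \<delta> \<rho> K F p r :: real
  assumes pos: "0 < hmin" "0 < \<rho>" "0 \<le> K" "0 \<le> F" "0 \<le> p" "0 \<le> r"
    and "hmin < h" and "\<delta> \<le> \<rho> * hmin" and growth: "F \<le> K * (1 + p)"
    and criterion: "(F \<noteq> 0 \<longrightarrow> h \<le> \<delta> / F) \<or> h \<le> \<delta> / (1 + p)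
      \<or> (F \<noteq> 0 \<longrightarrow> h \<le> \<delta> * r / F) \<or> h \<le> \<delta> * r / (1 + p)"
  shows "F\<^sup>2 \<le> ((1 + K) * \<rho>)\<^sup>2 + ((1 + K) * \<rho>)\<^sup>2 * r\<^sup>2"
proof -
  have step: "q \<le> \<rho> * s" if "h \<le> \<delta> * s / q" "0 < q" "0 \<le> s" for q s
    using capped_step_bounds_denominator[OF \<open>hmin < h\<close> that(1) \<open>\<delta> \<le> \<rho> * hmin\<close> \<open>0 < hmin\<close> that(2,3)] .
  have direct: "F \<le> (1 + K) * \<rho> * s" if "F \<noteq> 0 \<longrightarrow> h \<le> \<delta> * s / F" "0 \<le> s" for s
  proof -
    have nonneg: "0 \<le> \<rho> * s" "0 \<le> K * (\<rho> * s)" using pos that(2) by simp_all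
    have "F \<le> \<rho> * s" using step[of s F] that pos(4) nonneg by (cases "F = 0") auto
    then show ?thesis using nonneg by (simp add: algebra_simps)
  qed
  have via_growth: "F \<le> (1 + K) * \<rho> * s" if "h \<le> \<delta> * s / (1 + p)" "0 \<le> s" for s
  proof -
    have "1 + p \<le> \<rho> * s" using step that pos(5) by simp
    then have "F \<le> K * (\<rho> * s)" using growth mult_left_mono[OF _ pos(3)] by (meson order_trans)
    moreover have "0 \<le> \<rho> * s" using pos that(2) by simp
    ultimately show ?thesis by (simp add: algebra_simps)
  qed
  have "F \<le> (1 + K) * \<rho> * 1 \<or> F \<le> (1 + K) * \<rho> * r"
    using criterion direct[of 1] direct[of r] via_growth[of 1] via_growth[of r] pos(6) by auto
  then have "F\<^sup>2 \<le> ((1 + K) * \<rho> * 1)\<^sup>2 \<or> F\<^sup>2 \<le> ((1 + K) * \<rho> * r)\<^sup>2"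
    using power_mono pos(4) by blast
  moreover have "0 \<le> ((1 + K) * \<rho>)\<^sup>2" "0 \<le> ((1 + K) * \<rho>)\<^sup>2 * r\<^sup>2" by simp_all
  ultimately show ?thesis unfolding power_mult_distrib[of _ r] mult_1_right by linarith
qed

theorem lemma2p5:
  fixes M :: "'a measure"
    and W :: "real \<Rightarrow> 'a \<Rightarrow> real^'m"
    and f :: "real^'d \<Rightarrow> real^'d" and Df :: "real^'d \<Rightarrow> (real^'d) \<Rightarrow>\<^sub>L (real^'d)"
    and g :: "real^'d \<Rightarrow> real^'m^'d" and Dg :: "real^'d \<Rightarrow> (real^'d) \<Rightarrow>\<^sub>L (real^'m^'d)"
    and c \<alpha> \<kappa> T hmin hmax \<rho> \<delta> :: real
    and X0 :: "real^'d"
    and h :: "nat \<Rightarrow> 'a \<Rightarrow> real" and Y :: "nat \<Rightarrow> 'a \<Rightarrow> real^'d"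
  assumes "wiener_process M W" and "0 < T"
    and "continuously_differentiable f Df" and "continuously_differentiable g Dg"
    and "0 < c" and "0 < \<alpha>" and "0 < \<kappa>"
    and "\<And>x. norm (Df x) \<le> c * (1 + norm x powr c)"
    and "\<And>x y. (f x - f y) \<bullet> (x - y) \<le> \<alpha> * (norm (x - y))\<^sup>2"
    and "\<And>x y. norm (g x - g y) \<le> \<kappa> * norm (x - y)"
    and "timestepping_strategy M (natural_filtration M W) T hmin hmax \<rho> h"
    and "solves_scheme M W T hmin f g X0 h Y"
    and "\<delta> \<le> hmax"
    and "\<And>\<omega> n. \<lbrakk>\<omega> \<in> space M; n < num_steps T h \<omega>; hmin < h (Suc n) \<omega>; h (Suc n) \<omega> < hmax\<rbrakk> \<Longrightarrow>
           (f (Y n \<omega>) \<noteq> 0 \<longrightarrow> h (Suc n) \<omega> \<le> \<delta> / norm (f (Y n \<omega>)))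
         \<or> h (Suc n) \<omega> \<le> \<delta> / (1 + norm (Y n \<omega>) powr (1 + c))
         \<or> (f (Y n \<omega>) \<noteq> 0 \<longrightarrow> h (Suc n) \<omega> \<le> \<delta> * norm (Y n \<omega>) / norm (f (Y n \<omega>)))
         \<or> h (Suc n) \<omega> \<le> \<delta> * norm (Y n \<omega>) / (1 + norm (Y n \<omega>) powr (1 + c))"
  shows "(\<forall>x. norm (f x) \<le> (2 * c + norm (f 0)) * (1 + norm x powr (c + 1))) \<and>
    admissible_strategy M (natural_filtration M W) T hmin hmax \<rho> f Y h"
proof (intro conjI)
  show growth: "\<forall>x. norm (f x) \<le> (2 * c + norm (f 0)) * (1 + norm x powr (c + 1))"
    using polynomial_growth_of_derivative_bound[of f Df c] assms(3,5,8)
    by (auto simp: continuously_differentiable_def)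
  define K where "K = 2 * c + norm (f 0)"
  have "0 \<le> K" using \<open>0 < c\<close> by (simp add: K_def)
  have mesh_bounds: "0 < hmin" "0 < \<rho>" "hmax = \<rho> * hmin"
    using assms(11) by (auto simp: timestepping_strategy_def)
  have "(norm (f (Y n \<omega>)))\<^sup>2 \<le> ((1 + K) * \<rho>)\<^sup>2 + ((1 + K) * \<rho>)\<^sup>2 * (norm (Y n \<omega>))\<^sup>2"
    if "\<omega> \<in> space M" "n < num_steps T h \<omega>" "hmin < h (Suc n) \<omega>" "h (Suc n) \<omega> < hmax" for \<omega> n
  proof (rule drift_bound_of_step_criterion)
    show "norm (f (Y n \<omega>)) \<le> K * (1 + norm (Y n \<omega>) powr (1 + c))"
      using growth by (simp add: K_def add.commute)
    show "\<delta> \<le> \<rho> * hmin" using \<open>\<delta> \<le> hmax\<close> mesh_bounds by simp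
    show "hmin < h (Suc n) \<omega>" by fact
  qed (fact assms(14)[OF that] mesh_bounds(1,2) \<open>0 \<le> K\<close> norm_ge_zero powr_ge_zero
      | simp only: norm_eq_zero, fact assms(14)[OF that])+
  then show "admissible_strategy M (natural_filtration M W) T hmin hmax \<rho> f Y h"
    unfolding admissible_strategy_def using assms(11)
    by (intro conjI exI[of _ "((1 + K) * \<rho>)\<^sup>2"]) auto
qed

end
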